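(* Let $\mathcal{I}=\bigl(([s_i,e_i))_{i\in[n]},q,\mathcal{S}\bigr)$ be an instance of the extended version with an arbitrary set $\mathcal{S}$ of non-overlapping schedules. If there exists a balanced feasible assignment for $\mathcal{I}$, then there exists a balanced feasible assignment for $\mathcal{I}$ that is periodic. Moreover, in such a case, the periodic balanced feasible assignment can be chosen with period at most $q^2\,q!$.
   Context: Tasks: $n$ intervals $[s_i,e_i)\subseteq(-1,1)$, $i\in[n]$, with $e_i\in(0,1]$, $e_i-s_i\le 1$; the $r$th occurrence ($r\in\mathbb{Z}_{>0}$) of task $i$ occupies $[s_i+r,e_i+r)$; $q$ is a positive integer and workers are identified with $[q]$. Let $U(\mathcal{I})=\{i\in[n]: s_i\le 0\}$. A schedule is a pair $(T,W)$ with $T\subseteq[n]$ and either $W=\varnothing$ or $W=\{i\}$ with $i\in U(\mathcal{I})$. It is non-overlapping if for all $i'\in T$: $[s_{i'},e_{i'})\cap[s_{i''},e_{i''})=\varnothing$ for all $i''\in T\setminus\{i'\}$, and $[s_{i'},e_{i'})\cap[s_i+1,e_i+1)=\varnothing$ for all $i\in W$. An instance of the extended version is a triple $\bigl(([s_i,e_i))_{i\in[n]},q,\mathcal{S}\bigr)$ where $\mathcal{S}$ is a set of non-overlapping schedules. An assignment is a map $f:[n]\times\mathbb{Z}_{>0}\to[q]$. For a worker $j$ and a week $r\in\mathbb{Z}_{>0}$ (the time interval $(r,r+1]$), the schedule induced by $f$ is $(T,W)$ with $T=\{i\in[n]: f(i,r)=j\}$ (tasks whose occurrence finishing during week $r$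 is performed by $j$) and $W=\{i\in U(\mathcal{I}): f(i,r+1)=j\}$ (task starting during week $r$ and finishing during week $r+1$ performed by $j$). An assignment is feasible if all the schedules it induces belong to $\mathcal{S}$. It is balanced if for every $i\in[n]$ and $j\in[q]$ the limit $\lim_{t\to\infty}\frac1t|\{r\in[t]:f(i,r)=j\}|$ exists and equals $1/q$. It is periodic with period $h\in\mathbb{Z}_{>0}$ if $f(i,r)=f(i,r+h)$ for all $i,r$. *)

theory Defs
  imports Complex_Main "HOL-Library.FuncSet"
begin

text \<open>
  Tasks are indexed by \<open>{1..n}\<close>, workers by \<open>{1..q}\<close> and occurrences (weeks) by the
  positive naturals \<open>{0<..}\<close>. Task \<open>i\<close> is the interval \<open>{s i..<e i}\<close>.
\<close>

definition task_family :: "nat \<Rightarrow> (nat \<Rightarrow> real) \<Rightarrow> (nat \<Rightarrow> real) \<Rightarrow> bool" where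
  "task_family n s e \<longleftrightarrow>
     (\<forall>i\<in>{1..n}. {s i..<e i} \<subseteq> {-1<..<1} \<and> e i \<in> {0<..1} \<and> e i - s i \<le> 1)"

text \<open>The set \<open>U\<close> of tasks whose occurrences may span two consecutive weeks.\<close>

definition U_tasks :: "nat \<Rightarrow> (nat \<Rightarrow> real) \<Rightarrow> nat set" where
  "U_tasks n s = {i \<in> {1..n}. s i \<le> 0}"

type_synonym schedule = "nat set \<times> nat set"

definition is_schedule :: "nat \<Rightarrow> (nat \<Rightarrow> real) \<Rightarrow> schedule \<Rightarrow> bool" where
  "is_schedule n s = (\<lambda>(T, W).
     T \<subseteq> {1..n} \<and> (W = {} \<or> (\<exists>i\<in>U_tasks n s. W = {i})))"

definition non_overlapping :: "(nat \<Rightarrow> real) \<Rightarrow> (nat \<Rightarrow> real) \<Rightarrow> schedule \<Rightarrow> bool" where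
  "non_overlapping s e = (\<lambda>(T, W). \<forall>i'\<in>T.
     (\<forall>i''\<in>T - {i'}. {s i'..<e i'} \<inter> {s i''..<e i''} = {}) \<and>
     (\<forall>i\<in>W. {s i'..<e i'} \<inter> {s i + 1..<e i + 1} = {}))"

definition extended_instance ::
  "nat \<Rightarrow> (nat \<Rightarrow> real) \<Rightarrow> (nat \<Rightarrow> real) \<Rightarrow> nat \<Rightarrow> schedule set \<Rightarrow> bool" where
  "extended_instance n s e q S \<longleftrightarrow>
     task_family n s e \<and> 0 < q \<and>
     (\<forall>\<sigma>\<in>S. is_schedule n s \<sigma> \<and> non_overlapping s e \<sigma>)"

text \<open>The value of an assignment outside \<open>{1..n} \<times> {0<..}\<close> is irrelevant.\<close>

definition assignments :: "nat \<Rightarrow> nat \<Rightarrow> (nat \<times> nat \<Rightarrow> nat) set" where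
  "assignments n q = {1..n} \<times> {0<..} \<rightarrow> {1..q}"

definition induced_schedule ::
  "nat \<Rightarrow> (nat \<Rightarrow> real) \<Rightarrow> (nat \<times> nat \<Rightarrow> nat) \<Rightarrow> nat \<Rightarrow> nat \<Rightarrow> schedule" where
  "induced_schedule n s f j r =
     ({i \<in> {1..n}. f (i, r) = j}, {i \<in> U_tasks n s. f (i, r + 1) = j})"

definition feasible ::
  "nat \<Rightarrow> (nat \<Rightarrow> real) \<Rightarrow> nat \<Rightarrow> schedule set \<Rightarrow> (nat \<times> nat \<Rightarrow> nat) \<Rightarrow> bool" where
  "feasible n s q S f \<longleftrightarrow> (\<forall>j\<in>{1..q}. \<forall>r>0. induced_schedule n s f j r \<in> S)"

definition balanced :: "nat \<Rightarrow> nat \<Rightarrow> (nat \<times> nat \<Rightarrow> nat) \<Rightarrow> bool" where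
  "balanced n q f \<longleftrightarrow> (\<forall>i\<in>{1..n}. \<forall>j\<in>{1..q}.
     (\<lambda>t. 1 / real t * real (card {r \<in> {1..t}. f (i, r) = j})) \<longlonglongrightarrow> 1 / real q)"

definition periodic_with :: "nat \<Rightarrow> nat \<Rightarrow> (nat \<times> nat \<Rightarrow> nat) \<Rightarrow> bool" where
  "periodic_with n h f \<longleftrightarrow> 0 < h \<and> (\<forall>i\<in>{1..n}. \<forall>r>0. f (i, r) = f (i, r + h))"

end

theory Submission
  imports Defs "HOL-Combinatorics.Permutations" "Graph_Theory.Euler"
begin

text \<open>
  At the start of a week the only relevant information is which worker performs each task
  of \<open>U\<close>, an injection from \<open>U\<close> to the workers. All such injections are equivalent up to a
  permutation of the workers, so each week \<open>r\<close> of the given assignment can, after relabelling,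
  be played from any state, and it changes the state by a permutation \<open>\<pi> r\<close>. Balancedness
  makes the group generated by all \<open>\<pi> r\<close> transitive on the workers, and at most \<open>q\<close> of them
  already generate a transitive group \<open>\<Gamma>\<close>. An Eulerian circuit of the Cayley graph of \<open>\<Gamma>\<close>
  plays each of these weeks once from each element of \<open>\<Gamma>\<close>; by transitivity every task is then
  shared equally. The period is the number of arcs, at most \<open>q * fact q\<close>.
\<close>

section \<open>Monoids generated by permutations\<close>

text \<open>Elements are values of words whose letters are appended on the right, matching steps
  along the arcs of the Cayley graph below. For permutations of a finite set this monoid is already
  the generated group.\<close>

definition gen_monoid :: "('b \<Rightarrow> 'a \<Rightarrow> 'a) \<Rightarrow> 'b set \<Rightarrow> ('a \<Rightarrow> 'a) set" where
  "gen_monoid p R = (\<lambda>rs. fold (\<lambda>r g. g \<circ> p r) rs id) ` lists R"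

lemma id_in_gen_monoid: "id \<in> gen_monoid p R"
  unfolding gen_monoid_def by (rule image_eqI[of _ _ "[]"]) auto

lemma comp_gen_in_gen_monoid:
  assumes "g \<in> gen_monoid p R" "r \<in> R"
  shows "g \<circ> p r \<in> gen_monoid p R"
proof -
  obtain rs where "rs \<in> lists R" "g = fold (\<lambda>r g. g \<circ> p r) rs id"
    using assms(1) by (auto simp: gen_monoid_def)
  then show ?thesis
    unfolding gen_monoid_def using assms(2) by (intro image_eqI[of _ _ "rs @ [r]"]) auto
qed

lemma gen_monoid_induct [consumes 1, case_names id comp, induct set: gen_monoid]:
  assumes "g \<in> gen_monoid p R" and "P id"
    and "\<And>g r. g \<in> gen_monoid p R \<Longrightarrow> r \<in> R \<Longrightarrow> P g \<Longrightarrow> P (g \<circ> p r)"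
  shows "P g"
proof -
  obtain rs where rs: "rs \<in> lists R" "g = fold (\<lambda>r g. g \<circ> p r) rs id"
    using assms(1) by (auto simp: gen_monoid_def)
  have "P (fold (\<lambda>r g. g \<circ> p r) rs id)"
    using rs(1)
  proof (induction rs rule: rev_induct)
    case Nil
    show ?case using assms(2) by (simp add: id_def)
  next
    case (snoc r rs)
    let ?g = "fold (\<lambda>r g. g \<circ> p r) rs id"
    have "?g \<in> gen_monoid p R" "r \<in> R" using snoc.prems by (auto simp: gen_monoid_def)
    moreover have "P ?g" by (rule snoc.IH) (use snoc.prems in auto)
    ultimately have "P (?g \<circ> p r)" by (rule assms(3))
    moreover have "fold (\<lambda>r g. g \<circ> p r) (rs @ [r]) id = ?g \<circ> p r" by simp
    ultimately show ?case by metis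
  qed
  then show ?thesis using rs(2) by simp
qed

lemma gen_monoid_comp:
  assumes "g \<in> gen_monoid p R" "h \<in> gen_monoid p R"
  shows "g \<circ> h \<in> gen_monoid p R"
  using assms(2)
proof induction
  case id
  show ?case using assms(1) by (simp only: comp_id)
next
  case (comp h r)
  then have "g \<circ> h \<circ> p r \<in> gen_monoid p R" by (intro comp_gen_in_gen_monoid)
  then show ?case by (simp only: comp_assoc)
qed

lemma gen_in_gen_monoid: "r \<in> R \<Longrightarrow> p r \<in> gen_monoid p R"
  using comp_gen_in_gen_monoid[OF id_in_gen_monoid, of r R p] by simp

lemma gen_monoid_mono: "R \<subseteq> R' \<Longrightarrow> gen_monoid p R \<subseteq> gen_monoid p R'"
proof
  fix g assume "R \<subseteq> R'" "g \<in> gen_monoid p R"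
  from this(2,1) show "g \<in> gen_monoid p R'"
    by induction (blast intro: id_in_gen_monoid comp_gen_in_gen_monoid)+
qed

lemma gen_monoid_permutes:
  assumes "\<And>r. r \<in> R \<Longrightarrow> p r permutes A" "g \<in> gen_monoid p R"
  shows "g permutes A"
  using assms(2) by induction (blast intro: permutes_compose permutes_id assms(1))+

text \<open>Turns the recursive notion of a walk into statements about indices, so that a closed
  trail can be read as a cyclic sequence of arcs.\<close>

lemma (in pre_digraph) cas_nth:
  assumes "cas u es v"
  shows "Suc t < length es \<Longrightarrow> tail G (es ! Suc t) = head G (es ! t)"
    and "es \<noteq> [] \<Longrightarrow> tail G (hd es) = u \<and> head G (last es) = v"
proof -
  show "Suc t < length es \<Longrightarrow> tail G (es ! Suc t) = head G (es ! t)"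
    using assms
  proof (induction es arbitrary: u t)
    case (Cons e es)
    then show ?case by (cases t; cases es) auto
  qed simp
  show "es \<noteq> [] \<Longrightarrow> tail G (hd es) = u \<and> head G (last es) = v"
    using assms by (induction es arbitrary: u) auto
qed

section \<open>Finite permutation groups and the sizes of their fibres\<close>

locale perm_generators =
  fixes A :: "'a set" and p :: "'b \<Rightarrow> 'a \<Rightarrow> 'a" and R :: "'b set"
  assumes finite_points: "finite A" and finite_gens: "finite R"
    and gens_permute: "\<And>r. r \<in> R \<Longrightarrow> p r permutes A"
begin

abbreviation "\<Gamma> \<equiv> gen_monoid p R"

lemma permutes: "g \<in> \<Gamma> \<Longrightarrow> g permutes A"
  using gen_monoid_permutes gens_permute by blast

lemma subset_perms: "\<Gamma> \<subseteq> {g. g permutes A}"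
  using permutes by blast

lemma finite_monoid: "finite \<Gamma>"
  using subset_perms finite_permutations[OF finite_points] by (rule finite_subset)

lemma card_le_fact: "card \<Gamma> \<le> fact (card A)"
  using card_mono[OF finite_permutations[OF finite_points] subset_perms]
    card_permutations[OF refl finite_points] by simp

lemma card_pos: "card \<Gamma> > 0"
  using finite_monoid id_in_gen_monoid card_gt_0_iff by blast

text \<open>An injective self-map of a finite set is onto. Together with
  \<open>right_mult_bij\<close> this replaces explicit inverses: equations
  \<open>g \<circ> h = g'\<close> and \<open>h \<circ> g = g'\<close> are solvable in
  \<open>\<Gamma>\<close>.\<close>

lemma left_mult_bij:
  assumes "g \<in> \<Gamma>" shows "bij_betw (\<lambda>h. g \<circ> h) \<Gamma> \<Gamma>"
proof -
  have "inj_on (\<lambda>h. g \<circ> h) \<Gamma>"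
    using permutes_inj[OF permutes[OF assms]] by (auto simp: inj_on_def fun_eq_iff)
  moreover have "(\<lambda>h. g \<circ> h) ` \<Gamma> \<subseteq> \<Gamma>"
    using gen_monoid_comp[OF assms] by blast
  ultimately show ?thesis
    using endo_inj_surj[OF finite_monoid] by (auto simp: bij_betw_def)
qed

lemma right_mult_bij:
  assumes "g \<in> \<Gamma>" shows "bij_betw (\<lambda>h. h \<circ> g) \<Gamma> \<Gamma>"
proof -
  have "inj_on (\<lambda>h. h \<circ> g) \<Gamma>"
    using permutes_surj[OF permutes[OF assms]] by (auto simp: inj_on_def intro: surj_fun_eq)
  moreover have "(\<lambda>h. h \<circ> g) ` \<Gamma> \<subseteq> \<Gamma>"
    using gen_monoid_comp assms by blast
  ultimately show ?thesis
    using endo_inj_surj[OF finite_monoid] by (auto simp: bij_betw_def)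
qed

text \<open>If \<open>u\<close> sends \<open>k\<close> to \<open>c\<close> and \<open>v\<close>
  sends \<open>k\<close> to \<open>j\<close>, then right multiplication by \<open>u\<close> and left
  multiplication by \<open>v\<close> carry the two sides onto the same set, the elements sending
  \<open>k\<close> to \<open>j\<close>.\<close>

lemma card_fibre:
  assumes trans: "(\<lambda>g. g k) ` \<Gamma> = A" and k: "k \<in> A" and c: "c \<in> A" and j: "j \<in> A"
  shows "card {g \<in> \<Gamma>. g c = j} = card {g \<in> \<Gamma>. g k = k}"
proof -
  obtain u where u: "u \<in> \<Gamma>" "u k = c" using trans c by blast
  obtain v where v: "v \<in> \<Gamma>" "v k = j" using trans j by blast
  have inj_v: "v x = v y \<longleftrightarrow> x = y" for x y
    by (rule inj_eq[OF permutes_inj[OF permutes[OF v(1)]]])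
  have "bij_betw (\<lambda>h. h \<circ> u) {g \<in> \<Gamma>. g c = j} {g \<in> \<Gamma>. g k = j}"
  proof (rule bij_betw_Collect[OF right_mult_bij[OF u(1)]])
    show "(h \<circ> u) k = j \<longleftrightarrow> h c = j" for h by (simp add: u(2))
  qed
  moreover have "bij_betw (\<lambda>h. v \<circ> h) {g \<in> \<Gamma>. g k = k} {g \<in> \<Gamma>. g k = j}"
  proof (rule bij_betw_Collect[OF left_mult_bij[OF v(1)]])
    show "(v \<circ> h) k = j \<longleftrightarrow> h k = k" for h by (simp add: v(2)[symmetric] inj_v)
  qed
  ultimately show ?thesis by (auto dest!: bij_betw_same_card)
qed

text \<open>The possible images of \<open>c\<close> split \<open>\<Gamma>\<close> into
  \<open>card A\<close> classes of equal size. This equidistribution is the source of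
  balancedness.\<close>

lemma card_fibre_mult:
  assumes trans: "(\<lambda>g. g k) ` \<Gamma> = A" and k: "k \<in> A" and c: "c \<in> A" and j: "j \<in> A"
  shows "card A * card {g \<in> \<Gamma>. g c = j} = card \<Gamma>"
proof -
  have "\<Gamma> = (\<Union>i\<in>A. {g \<in> \<Gamma>. g c = i})"
    using permutes_in_image[OF permutes] c by blast
  then have "card \<Gamma> = card (\<Union>i\<in>A. {g \<in> \<Gamma>. g c = i})" by simp
  also have "\<dots> = (\<Sum>i\<in>A. card {g \<in> \<Gamma>. g c = i})"
    by (rule card_UN_disjoint) (auto simp: finite_points finite_monoid)
  also have "\<dots> = (\<Sum>i\<in>A. card {g \<in> \<Gamma>. g c = j})"
    by (intro sum.cong refl) (simp add: card_fibre[OF trans k c] j)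
  finally show ?thesis by simp
qed

section \<open>Eulerian circuits of the Cayley graph\<close>

text \<open>Arcs carry their generator index, so two indices with the same permutation give parallel
  arcs and each week is still counted separately.\<close>

definition cayley :: "('a \<Rightarrow> 'a, ('a \<Rightarrow> 'a) \<times> 'b) pre_digraph" where
  "cayley = \<lparr>verts = \<Gamma>, arcs = \<Gamma> \<times> R, tail = fst, head = (\<lambda>(g, r). g \<circ> p r)\<rparr>"

lemma cayley_simps [simp]:
  "verts cayley = \<Gamma>" "arcs cayley = \<Gamma> \<times> R" "tail cayley = fst"
  "head cayley = (\<lambda>(g, r). g \<circ> p r)"
  by (simp_all add: cayley_def)

sublocale cayley: fin_digraph cayley
  by unfold_locales
    (auto simp: finite_monoid finite_gens intro: comp_gen_in_gen_monoid)

text \<open>A word for \<open>h\<close>, read letter by letter from \<open>g\<close>, spells a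
  walk.\<close>

lemma cayley_reachable:
  assumes "g \<in> \<Gamma>" "h \<in> \<Gamma>" shows "g \<rightarrow>\<^sup>*\<^bsub>cayley\<^esub> (g \<circ> h)"
  using assms(2)
proof induction
  case id
  then show ?case using assms(1) by simp
next
  case (comp h r)
  have "(g \<circ> h, r) \<in> arcs cayley"
    using gen_monoid_comp[OF assms(1)] comp.hyps by simp
  then have "(g \<circ> h) \<rightarrow>\<^bsub>cayley\<^esub> (g \<circ> (h \<circ> p r))"
    using cayley.in_arcs_imp_in_arcs_ends[of "(g \<circ> h, r)"] by (simp add: comp_assoc)
  with comp.IH show ?case
    by (rule cayley.reachable_adj_trans)
qed

lemma cayley_connected: "connected cayley"
proof -
  have "g \<rightarrow>\<^sup>*\<^bsub>cayley\<^esub> g'" if g: "g \<in> \<Gamma>" and g': "g' \<in> \<Gamma>" for g g'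
  proof -
    obtain h where "h \<in> \<Gamma>" "g' = g \<circ> h"
      using left_mult_bij[OF g] g' unfolding bij_betw_def by blast
    then show ?thesis using cayley_reachable[OF g] by blast
  qed
  then show ?thesis
    using id_in_gen_monoid[of p R] cayley.reachable_mk_symmetricI
    unfolding connected_def strongly_connected_def by auto
qed

text \<open>Every vertex has exactly one outgoing and one incoming arc per generator index; the
  incoming one exists and is unique because right multiplication is a bijection.\<close>

lemma cayley_degrees:
  assumes "g \<in> \<Gamma>" shows "in_degree cayley g = out_degree cayley g"
proof -
  have "out_arcs cayley g = Pair g ` R"
    using assms by (auto simp: out_arcs_def)
  then have "out_degree cayley g = card R"
    by (simp add: out_degree_def card_image inj_on_def)
  moreover have "bij_betw snd (in_arcs cayley g) R"
    unfolding bij_betw_def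
  proof
    show "inj_on snd (in_arcs cayley g)"
    proof (rule inj_onI, clarsimp simp: in_arcs_def)
      fix a b r assume "a \<in> \<Gamma>" "b \<in> \<Gamma>" "r \<in> R" "b \<circ> p r = a \<circ> p r"
      then show "a = b"
        using right_mult_bij[OF gen_in_gen_monoid] unfolding bij_betw_def inj_on_def by metis
    qed
    have "r \<in> snd ` in_arcs cayley g" if r: "r \<in> R" for r
    proof -
      obtain h where "h \<in> \<Gamma>" "g = h \<circ> p r"
        using right_mult_bij[OF gen_in_gen_monoid[OF r]] assms unfolding bij_betw_def by blast
      then show ?thesis using r by (force simp: in_arcs_def)
    qed
    then show "snd ` in_arcs cayley g = R" by (auto simp: in_arcs_def)
  qed
  then have "in_degree cayley g = card R"
    by (simp add: in_degree_def bij_betw_same_card)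
  ultimately show ?thesis by simp
qed

text \<open>Connectedness and equal in- and out-degrees give a closed Euler trail; repeating it
  forever gives the periodic sequence \<open>w\<close>.\<close>

lemma eulerian_walk:
  assumes "R \<noteq> {}"
  defines "h \<equiv> card \<Gamma> * card R"
  shows "\<exists>w. bij_betw w {..<h} (\<Gamma> \<times> R) \<and> (\<forall>t. w (t + h) = w t \<and> w t \<in> \<Gamma> \<times> R \<and>
           fst (w (Suc t)) = fst (w t) \<circ> p (snd (w t)))"
proof -
  obtain u es where "cayley.euler_trail u es u"
    using cayley.closed_euler1[OF cayley_connected] cayley_degrees by auto
  then have cas: "cayley.cas u es u" and dist: "distinct es" and set: "set es = \<Gamma> \<times> R"
    by (auto simp: cayley.euler_trail_def cayley.trail_def cayley.awalk_def)
  have len: "length es = h"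
    using distinct_card[OF dist] unfolding set h_def by (simp add: card_cartesian_product)
  have h: "h > 0"
    using card_pos assms(1) finite_gens unfolding h_def by (simp add: card_gt_0_iff)
  then have ne: "es \<noteq> []" using len by auto
  define w where "w t = es ! (t mod h)" for t
  show ?thesis
  proof (intro exI[of _ w] conjI allI)
    have "bij_betw (\<lambda>t. es ! t) {..<h} (\<Gamma> \<times> R)"
      using bij_betw_nth[OF dist _ set[symmetric], of "{..<h}"] len by simp
    then show "bij_betw w {..<h} (\<Gamma> \<times> R)"
      by (subst bij_betw_cong[of _ _ "\<lambda>t. es ! t"]) (auto simp: w_def)
    show "w (t + h) = w t" for t by (simp add: w_def)
    show "w t \<in> \<Gamma> \<times> R" for t
      using nth_mem[of "t mod h" es] h len unfolding set w_def by simp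
    have "tail cayley (w (Suc t)) = head cayley (w t)" for t
    \<comment> \<open>At the wrap-around the arcs meet because the trail is closed; elsewhere they
      are consecutive in \<open>es\<close>.\<close>
    proof (cases "Suc (t mod h) = h")
      case True
      then have "Suc t mod h = 0" "t mod h = h - 1" by (auto simp: mod_Suc)
      then show ?thesis
        using cayley.cas_nth(2)[OF cas ne] len ne by (simp add: w_def hd_conv_nth last_conv_nth)
    next
      case False
      then have "Suc t mod h = Suc (t mod h)" "Suc (t mod h) < length es"
        using h len by (auto simp: mod_Suc Suc_lessI)
      then show ?thesis
        using cayley.cas_nth(1)[OF cas, of "t mod h"] by (simp add: w_def)
    qed
    then show "fst (w (Suc t)) = fst (w t) \<circ> p (snd (w t))" for t
      by (simp add: case_prod_beta)
  qed
qed

end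

section \<open>Small transitive generating sets\<close>

text \<open>Each new generator is chosen to enlarge the orbit of \<open>k\<close>, so \<open>card A\<close> of them suffice.\<close>

lemma few_transitive_generators:
  fixes p :: "'b \<Rightarrow> 'a \<Rightarrow> 'a"
  assumes fin: "finite A" and k: "k \<in> A" and perm: "\<And>r. p r permutes A"
    and inv: "\<And>B. B \<subseteq> A \<Longrightarrow> k \<in> B \<Longrightarrow> (\<And>r. p r ` B \<subseteq> B) \<Longrightarrow> B = A"
  obtains R where "finite R" "R \<noteq> {}" "card R \<le> card A" "(\<lambda>g. g k) ` gen_monoid p R = A"
proof -
  define orb where "orb R = (\<lambda>g. g k) ` gen_monoid p R" for R
  have orb_sub: "orb R \<subseteq> A" for R
  proof
    fix v assume "v \<in> orb R"
    then obtain g where g: "g \<in> gen_monoid p R" "v = g k" unfolding orb_def by (rule imageE)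
    have "g permutes A" using perm g(1) by (rule gen_monoid_permutes)
    then show "v \<in> A" using k g(2) by (simp add: permutes_in_image)
  qed
  have fin_orb: "finite (orb R)" for R
    using orb_sub fin by (rule finite_subset)
  have orb_mono: "orb R \<subseteq> orb R'" if "R \<subseteq> R'" for R R'
    unfolding orb_def by (intro image_mono gen_monoid_mono that)
  have k_orb: "k \<in> orb R" for R
    unfolding orb_def by (rule image_eqI[OF _ id_in_gen_monoid]) simp
  have "\<exists>R. finite R \<and> R \<noteq> {} \<and> card R \<le> Suc m \<and> (orb R = A \<or> Suc m \<le> card (orb R))" for m
  proof (induction m)
    case 0
    \<comment> \<open>An arbitrary first generator keeps \<open>R\<close> nonempty, as the Eulerian
      walk requires.\<close>
    have "0 < card (orb {undefined})"
      using k_orb fin_orb card_gt_0_iff by blast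
    then show ?case
      by (intro exI[of _ "{undefined}"]) (simp add: Suc_le_eq)
  next
    case (Suc m)
    then obtain R where R: "finite R" "R \<noteq> {}" "card R \<le> Suc m" "orb R = A \<or> Suc m \<le> card (orb R)"
      by blast
    show ?case
    proof (cases "orb R = A")
      case True
      then show ?thesis using R by (intro exI[of _ R]) auto
    next
      case False
      then obtain r where "\<not> p r ` orb R \<subseteq> orb R"
        using inv[OF orb_sub k_orb, of R] by meson
      then obtain v where v: "v \<in> orb R" "p r v \<notin> orb R" by blast
      from v(1) obtain g where g: "g \<in> gen_monoid p R" "v = g k" unfolding orb_def by (rule imageE)
      let ?R = "insert r R"
      \<comment> \<open>The new letter acts last on \<open>k\<close>, so it stands on the left of
        \<open>g\<close>, and closure under products is used instead of appending a letter.\<close>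
      have "p r \<circ> g \<in> gen_monoid p ?R"
        by (intro gen_monoid_comp gen_in_gen_monoid subsetD[OF gen_monoid_mono g(1)]) auto
      then have "p r v \<in> orb ?R" unfolding orb_def g(2) by (rule rev_image_eqI) simp
      moreover have "orb R \<subseteq> orb ?R" by (rule orb_mono) auto
      ultimately have "card (orb R) < card (orb ?R)"
        using v(2) fin_orb by (intro psubset_card_mono) auto
      moreover have "card ?R \<le> Suc (Suc m)"
        using R(1,3) by (simp add: card_insert_if)
      ultimately show ?thesis
        using R(1,4) False by (intro exI[of _ ?R]) simp
    qed
  qed
  from this[of "card A - 1"]
  obtain R where R: "finite R" "R \<noteq> {}" "card R \<le> Suc (card A - 1)"
    "orb R = A \<or> Suc (card A - 1) \<le> card (orb R)" by blast
  have A: "Suc (card A - 1) = card A" using k fin card_gt_0_iff[of A] by auto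
  have "orb R = A" using R(4) card_seteq[OF fin orb_sub, of R] unfolding A by blast
  then show ?thesis using that[OF R(1,2)] R(3) unfolding A orb_def by blast
qed

section \<open>Extending partial injections, and densities of periodic sets\<close>

text \<open>The images of \<open>x\<close> and \<open>y\<close> have the same size, hence so do
  their complements in \<open>A\<close>; any bijection \<open>b\<close> of the complements completes
  the matching.\<close>

lemma injections_related_by_permutation:
  assumes fin: "finite A" and x: "inj_on x I" "x ` I \<subseteq> A" and y: "inj_on y I" "y ` I \<subseteq> A"
  obtains p where "p permutes A" "\<And>i. i \<in> I \<Longrightarrow> p (x i) = y i"
proof -
  have finI: "finite (x ` I)" "finite (y ` I)" using x y fin finite_subset by blast+
  have "card (A - x ` I) = card (A - y ` I)"
    using x y finI by (simp add: card_Diff_subset card_image)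
  then obtain b where b: "bij_betw b (A - x ` I) (A - y ` I)"
    using finite_same_card_bij fin by (metis finite_Diff)
  define p where
    "p v = (if v \<in> x ` I then y (inv_into I x v) else if v \<in> A then b v else v)" for v
  have px: "p (x i) = y i" if "i \<in> I" for i
    using that x by (simp add: p_def)
  have "bij_betw p (x ` I) (y ` I)"
    unfolding bij_betw_def inj_on_def using px x y by (auto simp: inj_on_def image_iff)
  moreover have "bij_betw p (A - x ` I) (A - y ` I)"
    using b by (subst bij_betw_cong[of _ _ b]) (auto simp: p_def)
  ultimately have "bij_betw p (x ` I \<union> (A - x ` I)) (y ` I \<union> (A - y ` I))"
    by (rule bij_betw_combine) auto
  then have "bij_betw p A A" using x y by (simp add: Un_absorb1)
  moreover have "p v = v" if "v \<notin> A" for v using that x by (auto simp: p_def)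
  ultimately have "p permutes A" by (rule bij_imp_permutes)
  then show ?thesis using that px by blast
qed

text \<open>The counting function differs from a linear one by the error \<open>d\<close>, which has
  period \<open>h\<close> and so is bounded; dividing by \<open>t\<close> kills it.\<close>

lemma periodic_density:
  fixes P :: "nat \<Rightarrow> bool"
  assumes h: "h > 0" and per: "\<And>r. r > 0 \<Longrightarrow> P (r + h) = P r"
  shows "(\<lambda>t. 1 / real t * real (card {r \<in> {1..t}. P r}))
           \<longlonglongrightarrow> real (card {r \<in> {1..h}. P r}) / real h"
proof -
  define c where "c t = card {r \<in> {1..t}. P r}" for t
  have c0: "c 0 = 0" by (simp add: c_def)
  have cSuc: "c (Suc t) = c t + (if P (Suc t) then 1 else 0)" for t
  proof -
    have "{r \<in> {1..Suc t}. P r} =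
        (if P (Suc t) then insert (Suc t) {r \<in> {1..t}. P r} else {r \<in> {1..t}. P r})"
      by (auto simp: le_Suc_eq)
    then show ?thesis by (simp add: c_def)
  qed
  have cper: "c (t + h) = c t + c h" for t
  proof (induction t)
    case (Suc t)
    then show ?case using cSuc[of "t + h"] cSuc[of t] per[of "Suc t"] by simp
  qed (simp add: c0)
  define d where "d t = real (c t) - real t * (real (c h) / real h)" for t
  have dper: "d (t + h) = d t" for t
    unfolding d_def cper using h by (simp add: field_simps)
  have "d (t + m * h) = d t" for t m
    by (induction m) (use dper in \<open>simp_all add: add.assoc[symmetric] add.commute[of h]\<close>)
  from this[of "t mod h" "t div h" for t] have dmod: "d t = d (t mod h)" for t
    by (simp add: mod_div_mult_eq)
  have "\<bar>d t\<bar> \<le> Max ((\<lambda>t. \<bar>d t\<bar>) ` {..<h})" for t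
    using h by (subst dmod) (intro Max_ge, auto)
  then have "Bseq d" by (intro BseqI') auto
  moreover have "(\<lambda>t. inverse (real t)) \<longlonglongrightarrow> 0"
    by (rule tendsto_inverse_0_at_top) (rule filterlim_real_sequentially)
  ultimately have lim: "(\<lambda>t. inverse (real t) * d t) \<longlonglongrightarrow> 0"
    using Bseq_conv_Bfun bounded_bilinear.Zfun_prod_Bfun[OF bounded_bilinear_mult]
    by (simp add: tendsto_Zfun_iff)
  have "(\<lambda>t. real (c h) / real h + inverse (real t) * d t) \<longlonglongrightarrow> real (c h) / real h + 0"
    by (intro tendsto_add tendsto_const lim)
  moreover have "\<forall>\<^sub>F t in sequentially.
      real (c h) / real h + inverse (real t) * d t = 1 / real t * real (c t)"
    using eventually_gt_at_top[of 0]
    by eventually_elim (use h in \<open>simp add: d_def field_simps\<close>)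
  ultimately show ?thesis
    unfolding c_def[symmetric] by (simp add: tendsto_cong)
qed

section \<open>Periodic balanced assignments\<close>

text \<open>All tasks of \<open>U_tasks n s\<close> contain the time 0, so any two of them overlap
  and cannot share a worker.\<close>

lemma feasible_inj_on_U_tasks:
  assumes inst: "extended_instance n s e q S" and f: "f \<in> assignments n q"
    and feas: "feasible n s q S f" and r: "r > 0"
  shows "inj_on (\<lambda>i. f (i, r)) (U_tasks n s)"
proof (rule inj_onI, rule ccontr)
  fix i i' assume i: "i \<in> U_tasks n s" "i' \<in> U_tasks n s" and eq: "f (i, r) = f (i', r)"
    and ne: "i \<noteq> i'"
  have U: "i \<in> {1..n}" "s i \<le> 0" "i' \<in> {1..n}" "s i' \<le> 0" using i by (auto simp: U_tasks_def)
  have "f (i, r) \<in> {1..q}" using f U r by (auto simp: assignments_def Pi_def)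
  then have "induced_schedule n s f (f (i, r)) r \<in> S"
    using feas r by (auto simp: feasible_def)
  then have "non_overlapping s e (induced_schedule n s f (f (i, r)) r)"
    using inst by (auto simp: extended_instance_def)
  then have "{s i..<e i} \<inter> {s i'..<e i'} = {}"
    using U eq ne by (auto simp: non_overlapping_def induced_schedule_def)
  moreover have "e i > 0" "e i' > 0"
    using inst U by (auto simp: extended_instance_def task_family_def)
  then have "0 \<in> {s i..<e i} \<inter> {s i'..<e i'}" using U by simp
  ultimately show False by blast
qed

text \<open>
  The permutation \<open>\<tau> r\<close> carries the workers busy at the start of week \<open>1\<close> with a task of
  \<open>U\<close> to those busy with the same task at the start of week \<open>r + 1\<close>. Balancedness makes
  the orbit of such a worker exhaust \<open>{1..q}\<close>; if \<open>U\<close> is empty, \<open>\<tau>\<close> is unconstrained.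
\<close>

lemma transitive_relabelling:
  assumes inst: "extended_instance n s e q S" and f: "f \<in> assignments n q"
    and bal: "balanced n q f" and feas: "feasible n s q S f"
  obtains \<tau> :: "nat \<Rightarrow> nat \<Rightarrow> nat" and k where
    "\<And>r. \<tau> r permutes {1..q}" "\<tau> 0 = id"
    "\<And>r i. i \<in> U_tasks n s \<Longrightarrow> \<tau> r (f (i, 1)) = f (i, Suc r)"
    "k \<in> {1..q}" "\<And>j. j \<in> {1..q} \<Longrightarrow> \<exists>r. \<tau> r k = j"
proof (cases "U_tasks n s = {}")
  case True
  have q: "q > 0" using inst by (simp add: extended_instance_def)
  show ?thesis
  \<comment> \<open>These transpositions send 1 to every worker in turn, starting with the identity
    at \<open>r = 0\<close>.\<close>
  proof (rule that[of "\<lambda>r. transpose 1 (Suc (r mod q))" 1])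
    show "transpose 1 (Suc (r mod q)) permutes {1..q}" for r
      using q by (intro permutes_swap_id) (auto simp: Suc_le_eq)
    show "\<exists>r. transpose 1 (Suc (r mod q)) 1 = j" if "j \<in> {1..q}" for j
      using that by (intro exI[of _ "j - 1"]) auto
  qed (use True q in auto)
next
  case False
  then obtain i0 where i0: "i0 \<in> U_tasks n s" by blast
  then have i0n: "i0 \<in> {1..n}" by (auto simp: U_tasks_def)
  let ?U = "U_tasks n s"
  have range: "(\<lambda>i. f (i, r)) ` ?U \<subseteq> {1..q}" if "r > 0" for r
    using f that by (auto simp: assignments_def Pi_def U_tasks_def)
  have "\<exists>p. p permutes {1..q} \<and> (r = 0 \<longrightarrow> p = id) \<and> (\<forall>i\<in>?U. p (f (i, 1)) = f (i, Suc r))" for r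
  proof (cases "r = 0")
    case True
    then show ?thesis by (intro exI[of _ id]) (auto simp: permutes_id)
  next
    case False
    obtain p where "p permutes {1..q}" "\<And>i. i \<in> ?U \<Longrightarrow> p (f (i, 1)) = f (i, Suc r)"
      by (rule injections_related_by_permutation[of "{1..q}" "\<lambda>i. f (i, 1)" ?U "\<lambda>i. f (i, Suc r)"])
        (use range feasible_inj_on_U_tasks[OF inst f feas] in auto)
    then show ?thesis using False by auto
  qed
  then obtain \<tau> where \<tau>: "\<And>r. \<tau> r permutes {1..q}" "\<tau> 0 = id"
    "\<And>r i. i \<in> ?U \<Longrightarrow> \<tau> r (f (i, 1)) = f (i, Suc r)" by metis
  have "\<exists>r. \<tau> r (f (i0, 1)) = j" if j: "j \<in> {1..q}" for j
  \<comment> \<open>A worker outside the orbit would never perform \<open>i0\<close>, giving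
    frequency 0 instead of \<open>1 / real q\<close>.\<close>
  proof (rule ccontr)
    assume "\<nexists>r. \<tau> r (f (i0, 1)) = j"
    then have never: "f (i0, r) \<noteq> j" if "r > 0" for r
      using \<tau>(3)[OF i0, of "r - 1"] that by auto
    have none: "{r \<in> {1..t}. f (i0, r) = j} = {}" for t
      using never by auto
    have "(\<lambda>t. 1 / real t * real (card {r \<in> {1..t}. f (i0, r) = j})) \<longlonglongrightarrow> 1 / real q"
      using bal i0n j unfolding balanced_def by blast
    then have "(\<lambda>t. 0 :: real) \<longlonglongrightarrow> 1 / real q"
      unfolding none by simp
    then show False using j by (simp add: LIMSEQ_const_iff)
  qed
  then show ?thesis using that[of \<tau> "f (i0, 1)"] \<tau> range[of 1] i0 by auto
qed

lemma periodic_balanced_assignment: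
  assumes inst: "extended_instance n s e q S" and f: "f \<in> assignments n q"
    and bal: "balanced n q f" and feas: "feasible n s q S f"
  obtains f' h where "f' \<in> assignments n q" "balanced n q f'" "feasible n s q S f'"
    "periodic_with n h f'" "h \<le> q * fact q"
proof -
  obtain \<tau> k where \<tau>: "\<And>r. \<tau> r permutes {1..q}" and \<tau>0: "\<tau> 0 = id"
    and \<tau>U: "\<And>r i. i \<in> U_tasks n s \<Longrightarrow> \<tau> r (f (i, 1)) = f (i, Suc r)"
    and k: "k \<in> {1..q}" and hit: "\<And>j. j \<in> {1..q} \<Longrightarrow> \<exists>r. \<tau> r k = j"
    using transitive_relabelling[OF inst f bal feas] by metis
  \<comment> \<open>The change of state during week \<open>Suc r\<close>, written in the labels of
    week 1; \<open>\<tau>\<close> is indexed from 0, weeks from 1.\<close>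
  define p where "p r = inv (\<tau> r) \<circ> \<tau> (Suc r)" for r
  have p: "p r permutes {1..q}" for r
    unfolding p_def by (intro permutes_compose permutes_inv \<tau>)
  have \<tau>Suc: "\<tau> (Suc r) v = \<tau> r (p r v)" for r v
    by (simp add: p_def permutes_inverses[OF \<tau>])
  \<comment> \<open>\<open>\<tau> r\<close> is the product of the first \<open>r\<close> of the
    \<open>p\<close>, so an invariant set containing \<open>k\<close> contains every
    \<open>\<tau> r k\<close>, that is, every worker.\<close>
  have min: "B = {1..q}" if B: "B \<subseteq> {1..q}" "k \<in> B" "\<And>r. p r ` B \<subseteq> B" for B
  proof -
    have "\<forall>v\<in>B. \<tau> r v \<in> B" for r
    proof (induction r)
      case (Suc r)
      then show ?case using B(3)[of r] by (auto simp: \<tau>Suc)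
    qed (simp add: \<tau>0)
    then show ?thesis using B(1,2) hit by blast
  qed
  obtain R where R: "finite R" "R \<noteq> {}" "card R \<le> card {1..q}"
    and trans: "(\<lambda>g. g k) ` gen_monoid p R = {1..q}"
    by (rule few_transitive_generators[OF finite_atLeastAtMost k p min])
  interpret perm_generators "{1..q}" p R
    using R p by unfold_locales auto
  define h where "h = card \<Gamma> * card R"
  obtain w where w: "bij_betw w {..<h} (\<Gamma> \<times> R)" and wper: "\<And>t. w (t + h) = w t"
    and wmem: "\<And>t. w t \<in> \<Gamma> \<times> R"
    and wstep: "\<And>t. fst (w (Suc t)) = fst (w t) \<circ> p (snd (w t))"
    using eulerian_walk[OF R(2), folded h_def] by blast
  have h: "h > 0" using card_pos R by (simp add: h_def card_gt_0_iff)
  \<comment> \<open>The worker of task \<open>i\<close> in week \<open>Suc a\<close>, pulled back to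
    the labels of week 1. For tasks of \<open>U_tasks n s\<close> the result does not depend on
    \<open>a\<close>, which lets weeks be glued in any order.\<close>
  define base where "base a i = inv (\<tau> a) (f (i, Suc a))" for a i
  have base_mem: "base a i \<in> {1..q}" if "i \<in> {1..n}" for a i
    using f that permutes_in_image[OF permutes_inv[OF \<tau>[of a]]]
    by (auto simp: base_def assignments_def Pi_def)
  have base_U: "base a i = f (i, 1)" if "i \<in> U_tasks n s" for a i
    using \<tau>U[OF that, of a] permutes_inverses[OF \<tau>, of a] by (metis base_def)
  \<comment> \<open>If the arc \<open>w (r - 1)\<close> is \<open>(g, a)\<close>, week
    \<open>r\<close> replays week \<open>Suc a\<close> of \<open>f\<close> with workers renamed by
    \<open>g \<circ> inv (\<tau> a)\<close>. The shift arises because walks start at 0 and weeks at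
    1.\<close>
  define f' where "f' = (\<lambda>(i, r). fst (w (r - 1)) (base (snd (w (r - 1))) i))"
  have wperm: "fst (w t) permutes {1..q}" for t
    using permutes wmem[of t] by auto
  have per: "f' (i, r + h) = f' (i, r)" if "r > 0" for i r
    using wper[of "r - 1"] that by (simp add: f'_def)
  show ?thesis
  proof
    show "f' \<in> assignments n q"
      using base_mem permutes_in_image[OF wperm] by (auto simp: assignments_def f'_def)
    show "periodic_with n h f'"
      using per h by (simp add: periodic_with_def)
    show "h \<le> q * fact q"
      using mult_le_mono[OF card_le_fact R(3)] by (simp add: h_def mult.commute)
    show "feasible n s q S f'"
      unfolding feasible_def
    proof (intro ballI allI impI)
      fix j r :: nat assume j: "j \<in> {1..q}" and r: "r > 0"
      obtain g a where ga: "w (r - 1) = (g, a)" by fastforce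
      have g: "g permutes {1..q}" using wperm[of "r - 1"] ga by simp
      have next_g: "fst (w r) = g \<circ> p a" using wstep[of "r - 1"] ga r by simp
      \<comment> \<open>The worker whose role in week \<open>Suc a\<close> of \<open>f\<close> is
        taken over by \<open>j\<close>.\<close>
      let ?j = "\<tau> a (inv g j)"
      have pull: "g (inv (\<tau> a) v) = j \<longleftrightarrow> v = ?j" for v
        using permutes_inverses[OF g] permutes_inverses[OF \<tau>[of a]] by metis
      have "f' (i, r) = j \<longleftrightarrow> f (i, Suc a) = ?j" for i
        using ga by (simp add: f'_def base_def pull)
      \<comment> \<open>Whatever week is replayed next, its tasks of \<open>U_tasks n s\<close>
        start from the state \<open>g \<circ> p a\<close>, which is the renamed state after week
        \<open>Suc a\<close>.\<close>
      moreover have "f' (i, r + 1) = j \<longleftrightarrow> f (i, Suc a + 1) = ?j" if "i \<in> U_tasks n s" for i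
        using \<tau>U[OF that, of "Suc a"]
        by (simp add: f'_def base_U[OF that] next_g p_def pull)
      ultimately have "induced_schedule n s f' j r = induced_schedule n s f ?j (Suc a)"
        by (auto simp: induced_schedule_def)
      moreover have "?j \<in> {1..q}"
        using j permutes_in_image[OF \<tau>] permutes_in_image[OF permutes_inv[OF g]] by blast
      ultimately show "induced_schedule n s f' j r \<in> S"
        using feas by (simp add: feasible_def)
    qed
    show "balanced n q f'"
      unfolding balanced_def
    proof (intro ballI)
      fix i j assume i: "i \<in> {1..n}" and j: "j \<in> {1..q}"
      have "bij_betw (\<lambda>r. w (r - 1)) {1..h} (\<Gamma> \<times> R)"
      proof -
        have "bij_betw (\<lambda>r. r - 1) {1..h} {..<h}"
          by (rule bij_betw_byWitness[of _ Suc]) auto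
        then show ?thesis using bij_betw_trans[OF _ w] by (auto simp: comp_def)
      qed
      then have "bij_betw (\<lambda>r. w (r - 1)) {r \<in> {1..h}. f' (i, r) = j}
          {x \<in> \<Gamma> \<times> R. fst x (base (snd x) i) = j}"
        by (rule bij_betw_Collect) (simp add: f'_def)
      then have "card {r \<in> {1..h}. f' (i, r) = j} = card {x \<in> \<Gamma> \<times> R. fst x (base (snd x) i) = j}"
        by (rule bij_betw_same_card)
      \<comment> \<open>Sorting the arcs by replayed week: for each \<open>a\<close>, a share
        \<open>1 / q\<close> of the elements of \<open>\<Gamma>\<close> sends
        \<open>base a i\<close> to \<open>j\<close>.\<close>
      also have "{x \<in> \<Gamma> \<times> R. fst x (base (snd x) i) = j} =
          (\<lambda>(a, g). (g, a)) ` (SIGMA a:R. {g \<in> \<Gamma>. g (base a i) = j})"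
        by (auto simp: image_iff)
      also have "card \<dots> = (\<Sum>a\<in>R. card {g \<in> \<Gamma>. g (base a i) = j})"
        by (subst card_image) (auto simp: inj_on_def R finite_monoid)
      finally have "q * card {r \<in> {1..h}. f' (i, r) = j} =
          (\<Sum>a\<in>R. q * card {g \<in> \<Gamma>. g (base a i) = j})"
        by (simp add: sum_distrib_left)
      also have "\<dots> = (\<Sum>a\<in>R. card \<Gamma>)"
        using card_fibre_mult[OF trans k base_mem[OF i] j] by simp
      finally have "q * card {r \<in> {1..h}. f' (i, r) = j} = h"
        by (simp add: h_def)
      then have "real q * real (card {r \<in> {1..h}. f' (i, r) = j}) = real h"
        by (metis of_nat_mult)
      then have "real (card {r \<in> {1..h}. f' (i, r) = j}) / real h = 1 / real q"
        using h j by (simp add: field_simps)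
      then show "(\<lambda>t. 1 / real t * real (card {r \<in> {1..t}. f' (i, r) = j})) \<longlonglongrightarrow> 1 / real q"
        using periodic_density[of h "\<lambda>r. f' (i, r) = j"] h per by simp
    qed
  qed
qed

theorem theorem1p3:
  fixes n q :: nat and s e :: "nat \<Rightarrow> real" and S :: "schedule set"
  assumes "extended_instance n s e q S"
    and "\<exists>f\<in>assignments n q. balanced n q f \<and> feasible n s q S f"
  shows "(\<exists>f\<in>assignments n q. balanced n q f \<and> feasible n s q S f \<and>
            (\<exists>h. periodic_with n h f)) \<and>
         (\<exists>f\<in>assignments n q. balanced n q f \<and> feasible n s q S f \<and>
            (\<exists>h. periodic_with n h f \<and> h \<le> q\<^sup>2 * fact q))"
proof -
  from assms(2) obtain f where "f \<in> assignments n q" "balanced n q f" "feasible n s q S f"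
    by blast
  then obtain f' h where f': "f' \<in> assignments n q" "balanced n q f'" "feasible n s q S f'"
    "periodic_with n h f'" "h \<le> q * fact q"
    using periodic_balanced_assignment[OF assms(1)] by metis
  have "q * fact q \<le> q\<^sup>2 * fact q"
    by (simp add: power2_eq_square)
  then have "h \<le> q\<^sup>2 * fact q" using f'(5) by linarith
  then show ?thesis using f' by blast
qed

end
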